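(* There exists an absolute constant $c>0$ such that the following holds. Let $n$ be a positive integer, let $A \subset \{0,1\}^{n}$ be non-empty, and suppose that \[|\partial A| \leq |A| \log_{2}(2^{n}/|A|) + \epsilon |A|\] for some real number $\epsilon \leq c$. Then there exists a subcube $C$ of $\{0,1\}^n$ such that \[|A \Delta C| < \delta_{0}(\epsilon) |A|,\] where $\delta_{0}(\epsilon)$ is the smallest positive solution $x$ of \[x\log_{2}(1/x) - 3x = \epsilon.\]
   Context: $Q_n$ denotes the $n$-dimensional hypercube graph: its vertex set is $\{0,1\}^n$, and two 0-1 vectors are joined if and only if they differ in exactly one coordinate. For $A \subset \{0,1\}^n$, the edge-boundary $\partial A$ is the set of all edges of $Q_n$ joining a point in $A$ to a point not in $A$. A subcube of $\{0,1\}^n$ is a set of the form $\{x \in \{0,1\}^{n}: x_{i_1}=a_1,\ldots,x_{i_{m}}=a_{m}\}$, where $0 \leq m \leq n$, $i_1<\cdots<i_m$ are coordinates in $[n]=\{1,\ldots,n\}$, and $a_1,\ldots,a_m\in\{0,1\}$ are fixed; $m$ is its codimension and $n-m$ its dimension. $A \Delta C$ denotes the symmetric difference. *)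

theory Defs
  imports Complex_Main "HOL-Library.FuncSet"
begin

(* Vectors in {0,1}^n are extensional functions on {1..n}, so that set equality, cardinality and
   symmetric difference in cube n are those of {0,1}^n. *)
definition cube :: "nat \<Rightarrow> (nat \<Rightarrow> nat) set" where
  "cube n = {1..n} \<rightarrow>\<^sub>E {0, 1}"

definition cube_edges :: "nat \<Rightarrow> (nat \<Rightarrow> nat) set set" where
  "cube_edges n =
     {{x, y} | x y. x \<in> cube n \<and> y \<in> cube n \<and> card {i \<in> {1..n}. x i \<noteq> y i} = 1}"

definition edge_boundary :: "nat \<Rightarrow> (nat \<Rightarrow> nat) set \<Rightarrow> (nat \<Rightarrow> nat) set set" where
  "edge_boundary n A = {e \<in> cube_edges n. \<exists>x \<in> A. \<exists>y \<in> cube n - A. e = {x, y}}"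

(* S is the set of fixed coordinates; its cardinality is the codimension. *)
definition is_subcube :: "nat \<Rightarrow> (nat \<Rightarrow> nat) set \<Rightarrow> bool" where
  "is_subcube n C \<longleftrightarrow>
     (\<exists>S a. S \<subseteq> {1..n} \<and> a \<in> S \<rightarrow> {0, 1} \<and> C = {x \<in> cube n. \<forall>i \<in> S. x i = a i})"

(* The least solution exists exactly when \<epsilon> is at most the maximum 1 / (8 e ln 2) of the left-hand
   side over x > 0 (attained at x = 1 / (8 e)); for larger \<epsilon> the value is unspecified.
   For \<epsilon> = 0 it is 1/8. *)
definition delta0 :: "real \<Rightarrow> real" where
  "delta0 \<epsilon> = (LEAST x. x > 0 \<and> x * log 2 (1 / x) - 3 * x = \<epsilon>)"

end

theory Submission
  imports Defs "HOL-Analysis.Harmonic_Numbers"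
begin

text \<open>
  Write \<open>M = |A|\<close> and count the ordered pairs of neighbours inside \<open>A\<close>. As the cube is
  \<open>n\<close>-regular, the hypothesis on the boundary says that \<open>A\<close> spans at least
  \<open>M (log 2 M - \<epsilon>)\<close> such pairs. So everything is about the quantity
  \<open>excess n A = M log 2 M - links n A A\<close>, which no longer depends on the ambient dimension:
  it is nonnegative (this is the edge-isoperimetric inequality), and a set with excess at most
  \<open>\<epsilon> M\<close> is to be shown close to a subcube.

  Cutting \<open>A\<close> along a coordinate into parts of sizes \<open>a \<ge> b > 0\<close> changes the excess in a
  controlled way: the excess of \<open>A\<close> is the sum of those of the two parts, plus \<open>a + b\<close> times the
  binary entropy of \<open>b / (a + b)\<close>, minus twice the number of edges between the parts, of which
  there are at most \<open>b\<close>. The entropy term is at least \<open>2 b\<close>, and it exceeds \<open>2 b\<close>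
  substantially unless \<open>b\<close> is tiny or nearly \<open>a\<close>. This gives nonnegativity by induction,
  and it tells that in a set of small excess every coordinate that is not constant either is nearly
  constant or cuts the set into nearly equal parts with an almost perfect matching between them.

  The second ingredient is a direct estimate (\<open>excess_near_subcube\<close>): if \<open>A\<close> differs from a
  subcube in \<open>d = x M\<close> points, where \<open>0 < d < M\<close>, then the excess is larger than
  \<open>M (x log 2 (1 / x) - 3 x)\<close>. It has two consequences. First, it is the bound of the theorem, once
  \<open>x\<close> is known to lie in the range where \<open>x log 2 (1 / x) - 3 x\<close> increases. Second, it
  creates a gap: a set of excess at most \<open>M / 128\<close> cannot be at relative distance between
  \<open>1 / 32\<close> and \<open>1 / 16\<close> from a subcube.

  The gap makes an induction on \<open>|A|\<close> possible (\<open>near_subcube_if_small_excess\<close>): one of the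
  two parts of \<open>A\<close> again has relative excess at most \<open>1 / 128\<close>, hence is within relative distance
  \<open>1 / 32\<close> of a subcube. Either that subcube or the one twice as large is within \<open>1 / 16\<close> of
  \<open>A\<close>, and the gap improves \<open>1 / 16\<close> back to \<open>1 / 32\<close>, so that no error accumulates.
\<close>

section \<open>Entropy inequalities\<close>

lemma ln_2_bounds: "2 / 3 \<le> ln (2::real)" "ln (2::real) \<le> 8 / 9"
  using ln2_ge_two_thirds ln2_le_25_over_36 by simp_all

lemma log_2_le: "log 2 x \<le> 3 / 2 * (x - 1)" if "1 \<le> x" for x :: real
proof -
  have "ln x \<le> x - 1"
    using that by (intro ln_le_minus_one) auto
  also have "\<dots> \<le> 3 / 2 * (x - 1) * ln 2"
    using mult_left_mono[of 1 "3 / 2 * ln 2" "x - 1"] ln_2_bounds that by (simp add: algebra_simps)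
  finally show ?thesis
    by (simp add: log_def field_simps)
qed

text \<open>This is \<open>a + b\<close> times the binary entropy of \<open>b / (a + b)\<close>, in a form that needs no
  division and matches the splitting of the excess.\<close>
definition merge_gain :: "real \<Rightarrow> real \<Rightarrow> real" where
  "merge_gain a b = (a + b) * log 2 (a + b) - a * log 2 a - b * log 2 b"

text \<open>
  Of the two terms of the entropy, \<open>b log 2 ((a + b) / b)\<close> contributes \<open>3 / 2\<close> per unit of
  \<open>b\<close> because \<open>log 2 3 \<ge> 3 / 2\<close>, and \<open>a log 2 ((a + b) / a)\<close> contributes about
  \<open>(a / (a + b)) / ln 2\<close>. Any constant greater than \<open>2\<close> would express that unequal parts are
  costly; its distance to \<open>2\<close> limits the admissible excess.
\<close>
lemma merge_gain_unbalanced: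
  assumes "0 < b" "2 * b \<le> a"
  shows "9 / 4 * b \<le> merge_gain a b"
proof -
  have a: "0 < a" using assms by simp
  have eq: "merge_gain a b = a * log 2 ((a + b) / a) + b * log 2 ((a + b) / b)"
    using assms a by (simp add: merge_gain_def log_divide algebra_simps)
  have "3 / 2 = log 2 (2 powr (3 / 2))"
    by simp
  also have "\<dots> \<le> log 2 ((a + b) / b)"
  proof -
    have "(2 powr (3 / 2 :: real)) ^ 2 = (8::real)"
      by (simp add: powr_powr flip: powr_numeral)
    then have "(2 powr (3 / 2 :: real)) ^ 2 \<le> 3 ^ 2" by simp
    then have "2 powr (3 / 2 :: real) \<le> 3"
      by (rule power2_le_imp_le) simp
    also have "\<dots> \<le> (a + b) / b"
      using assms by (simp add: field_simps)
    finally show ?thesis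
      using assms a by (subst log_le_cancel_iff) auto
  qed
  finally have 1: "3 / 2 * b \<le> b * log 2 ((a + b) / b)"
    using mult_left_mono[of "3/2" _ b] assms by (simp add: mult.commute)
  have "ln (a / (a + b)) \<le> a / (a + b) - 1"
    using assms a by (intro ln_le_minus_one) auto
  also have "a / (a + b) - 1 = - (b / (a + b))"
    using assms a by (simp add: field_simps)
  finally have "b / (a + b) \<le> ln ((a + b) / a)"
    using assms a by (simp add: ln_div)
  then have "a * (b / (a + b)) \<le> a * ln ((a + b) / a)"
    using a by (intro mult_left_mono) auto
  moreover have "2 / 3 * b \<le> a * (b / (a + b))"
  proof -
    have "2 / 3 \<le> a / (a + b)" using assms a by (simp add: field_simps)
    then have "2 / 3 * b \<le> a / (a + b) * b" using assms by (intro mult_right_mono) auto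
    then show ?thesis by (simp add: mult.commute)
  qed
  ultimately have "2 / 3 * b \<le> a * ln ((a + b) / a)" by linarith
  moreover have "3 / 4 * b * ln 2 \<le> 2 / 3 * b"
    using mult_left_mono[of "ln 2" "8 / 9" "3 / 4 * b"] ln_2_bounds assms by simp
  ultimately have "3 / 4 * b \<le> a * log 2 ((a + b) / a)"
    by (simp add: log_def field_simps)
  with 1 show ?thesis unfolding eq by linarith
qed

text \<open>
  The entropy falls short of its maximum \<open>a + b\<close> by a relative entropy with respect to the uniform
  distribution, and \<open>ln z \<le> z - 1\<close> bounds that by the chi-square distance
  \<open>(a - b)\<^sup>2 / (a + b)\<close>, up to the factor \<open>1 / ln 2\<close>. For \<open>a \<le> 2 b\<close> the square is
  dominated by a linear function of \<open>a - b\<close>.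
\<close>
lemma merge_gain_balanced:
  assumes "0 < b" "b \<le> a" "a \<le> 2 * b"
  shows "(a + 3 * b) / 2 \<le> merge_gain a b"
proof -
  define M where "M = a + b"
  have pos: "0 < a" "0 < M" using assms by (auto simp: M_def)
  have eq: "merge_gain a b = M - (a * log 2 (2 * a / M) + b * log 2 (2 * b / M))"
    using assms pos by (simp add: merge_gain_def M_def[symmetric] log_divide log_mult algebra_simps)
      (simp add: M_def algebra_simps)
  have "a * ln (2 * a / M) + b * ln (2 * b / M) \<le> a * (2 * a / M - 1) + b * (2 * b / M - 1)"
    using assms pos by (intro add_mono mult_left_mono ln_le_minus_one) auto
  also have "\<dots> = (a - b) * (a - b) / M"
    using pos by (simp add: field_simps) (simp add: M_def algebra_simps)
  also have "\<dots> \<le> (a - b) * (1 / 3)"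
  proof -
    have "(a - b) / M \<le> 1 / 3" using assms pos by (simp add: M_def field_simps)
    then have "(a - b) * ((a - b) / M) \<le> (a - b) * (1 / 3)"
      using assms by (intro mult_left_mono) auto
    then show ?thesis by simp
  qed
  also have "\<dots> \<le> (a - b) / 2 * ln 2"
    using mult_left_mono[of "2 / 3" "ln 2" "(a - b) / 2"] ln_2_bounds assms by simp
  finally have "a * log 2 (2 * a / M) + b * log 2 (2 * b / M) \<le> (a - b) / 2"
    by (simp add: log_def field_simps)
  then show ?thesis unfolding eq by (simp add: M_def field_simps)
qed

lemma merge_gain_ge_twice:
  assumes "0 < b" "b \<le> a"
  shows "2 * b \<le> merge_gain a b"
proof (cases "2 * b \<le> a")
  case True
  then show ?thesis using merge_gain_unbalanced[of b a] assms by linarith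
next
  case False
  then have "(a + 3 * b) / 2 \<le> merge_gain a b" using merge_gain_balanced assms by simp
  then show ?thesis using assms by simp
qed

section \<open>Counting edges of the cube\<close>

text \<open>On vertices of the cube this reflects the coordinate \<open>i\<close>; the neighbours of a vertex are its
  images under the \<open>n\<close> reflections.\<close>
definition flip :: "nat \<Rightarrow> (nat \<Rightarrow> nat) \<Rightarrow> nat \<Rightarrow> nat" where
  "flip i x = x(i := 1 - x i)"

lemma cube_value: "x \<in> cube n \<Longrightarrow> i \<in> {1..n} \<Longrightarrow> x i = 0 \<or> x i = 1"
  unfolding cube_def by (drule (1) PiE_mem) simp

lemma flip_in_cube: "x \<in> cube n \<Longrightarrow> i \<in> {1..n} \<Longrightarrow> flip i x \<in> cube n"
  using cube_value[of x n i] by (auto simp: cube_def flip_def PiE_iff extensional_def)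

lemma flip_flip: "x \<in> cube n \<Longrightarrow> i \<in> {1..n} \<Longrightarrow> flip i (flip i x) = x"
  using cube_value[of x n i] by (auto simp: flip_def)

lemma flip_same: "flip i x i = 1 - x i"
  by (simp add: flip_def)

lemma flip_other: "j \<noteq> i \<Longrightarrow> flip i x j = x j"
  by (simp add: flip_def)

lemma flip_same_neq: "x \<in> cube n \<Longrightarrow> i \<in> {1..n} \<Longrightarrow> flip i x i \<noteq> x i"
  using cube_value[of x n i] by (auto simp: flip_def)

lemma inj_on_flip: "i \<in> {1..n} \<Longrightarrow> inj_on (flip i) (cube n)"
  by (rule inj_on_inverseI[where g = "flip i"]) (simp add: flip_flip del: atLeastAtMost_iff)

lemma finite_cube: "finite (cube n)"
  unfolding cube_def by (intro finite_PiE) auto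

lemma finite_subset_cube: "A \<subseteq> cube n \<Longrightarrow> finite A"
  by (rule finite_subset[OF _ finite_cube])

text \<open>
  The number of ordered pairs of neighbours with first entry in \<open>X\<close> and second entry in \<open>Y\<close>. For
  disjoint sets this is the number of edges between them, whereas \<open>links n X X\<close> is twice the
  number of edges inside \<open>X\<close>. Counting ordered pairs makes the function biadditive.
\<close>
definition links :: "nat \<Rightarrow> (nat \<Rightarrow> nat) set \<Rightarrow> (nat \<Rightarrow> nat) set \<Rightarrow> nat" where
  "links n X Y = (\<Sum>i\<in>{1..n}. card {x \<in> X. flip i x \<in> Y})"

lemma links_commute:
  assumes "X \<subseteq> cube n" "Y \<subseteq> cube n"
  shows "links n X Y = links n Y X"
  unfolding links_def
proof (rule sum.cong[OF refl])
  fix i assume i: "i \<in> {1..n}"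
  have "bij_betw (flip i) {x \<in> X. flip i x \<in> Y} {y \<in> Y. flip i y \<in> X}"
    using assms i by (intro bij_betw_byWitness[where f' = "flip i"]) (auto simp: flip_flip subset_iff)
  then show "card {x \<in> X. flip i x \<in> Y} = card {y \<in> Y. flip i y \<in> X}"
    by (rule bij_betw_same_card)
qed

lemma links_Un_left:
  assumes "finite X" "finite X'" "X \<inter> X' = {}"
  shows "links n (X \<union> X') Y = links n X Y + links n X' Y"
proof -
  have "card {x \<in> X \<union> X'. flip i x \<in> Y} = card {x \<in> X. flip i x \<in> Y} + card {x \<in> X'. flip i x \<in> Y}" for i
  proof -
    have "{x \<in> X \<union> X'. flip i x \<in> Y} = {x \<in> X. flip i x \<in> Y} \<union> {x \<in> X'. flip i x \<in> Y}" by auto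
    then show ?thesis using assms by (simp add: card_Un_disjoint disjoint_iff)
  qed
  then show ?thesis by (simp add: links_def sum.distrib)
qed

lemma links_Un_self:
  assumes "P \<subseteq> cube n" "Q \<subseteq> cube n" "P \<inter> Q = {}"
  shows "links n (P \<union> Q) (P \<union> Q) = links n P P + links n Q Q + 2 * links n P Q"
proof -
  note fin = finite_subset_cube[OF assms(1)] finite_subset_cube[OF assms(2)]
  have "links n X (P \<union> Q) = links n X P + links n X Q" if "X \<subseteq> cube n" for X
    using assms that links_Un_left[OF fin assms(3)]
    by (simp add: links_commute[of X n])
  then show ?thesis
    using assms links_Un_left[OF fin assms(3)] links_commute[OF assms(1,2)] by simp
qed

lemma links_across_coordinate:
  assumes "i \<in> {1..n}" "\<forall>x\<in>P. x i = v" "\<forall>x\<in>Q. x i \<noteq> v"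
  shows "links n P Q = card {x \<in> P. flip i x \<in> Q}"
proof -
  have "links n P Q = (\<Sum>j\<in>{1..n}. if j = i then card {x \<in> P. flip i x \<in> Q} else 0)"
    unfolding links_def
  proof (rule sum.cong[OF refl])
    fix j
    have "{x \<in> P. flip j x \<in> Q} = {}" if "j \<noteq> i"
      using assms that flip_other[of i j] by auto
    then show "card {x \<in> P. flip j x \<in> Q} = (if j = i then card {x \<in> P. flip i x \<in> Q} else 0)"
      by (metis card.empty)
  qed
  then show ?thesis using assms by simp
qed

text \<open>Between the two sides of a coordinate the edges of the cube form a matching.\<close>
lemma links_across_coordinate_le:
  assumes "i \<in> {1..n}" "\<forall>x\<in>P. x i = v" "\<forall>x\<in>Q. x i \<noteq> v" "P \<subseteq> cube n" "Q \<subseteq> cube n"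
  shows "links n P Q \<le> card Q"
proof -
  have eq: "links n P Q = card {x \<in> P. flip i x \<in> Q}"
    using links_across_coordinate assms by blast
  show "links n P Q \<le> card Q"
    unfolding eq
  proof (rule card_inj_on_le[of "flip i"])
    show "inj_on (flip i) {x \<in> P. flip i x \<in> Q}"
      by (rule inj_on_subset[OF inj_on_flip]) (use assms in auto)
  qed (use assms finite_subset_cube[of _ n] in auto)
qed

text \<open>
  The amount by which the edge boundary exceeds \<open>|A| log 2 (2^n / |A|)\<close>, after the boundary has been
  replaced by \<open>n |A| - links n A A\<close>. In terms of a uniform random point of \<open>A\<close>, it is \<open>|A|\<close>
  times the difference between the entropy of the point and the sum of the conditional entropies of
  its coordinates, each given all others.
\<close>
definition excess :: "nat \<Rightarrow> (nat \<Rightarrow> nat) set \<Rightarrow> real" where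
  "excess n A = real (card A) * log 2 (real (card A)) - real (links n A A)"

text \<open>
  Of the \<open>n |A|\<close> pairs of a point of \<open>A\<close> and a direction, those that leave \<open>A\<close> yield distinct
  boundary edges, since the end in \<open>A\<close> and the direction can be read off from the edge.
\<close>
lemma excess_le_edge_boundary:
  assumes "A \<subseteq> cube n"
  shows "excess n A
    \<le> real (card (edge_boundary n A)) - real (card A) * (real n - log 2 (real (card A)))"
proof -
  let ?out = "\<lambda>i. {x \<in> A. flip i x \<notin> A}"
  let ?f = "\<lambda>(i, x). {x, flip i x}"
  note fin = finite_subset_cube[OF assms]
  have "card A = card {x \<in> A. flip i x \<in> A} + card (?out i)" for i
  proof -
    have "A = {x \<in> A. flip i x \<in> A} \<union> ?out i" by auto
    then show ?thesis using fin by (metis (no_types, lifting) card_Un_disjoint disjoint_iff finite_Un mem_Collect_eq)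
  qed
  then have "(\<Sum>i\<in>{1..n}. card A) = links n A A + (\<Sum>i\<in>{1..n}. card (?out i))"
    unfolding links_def sum.distrib[symmetric] by presburger
  then have "n * card A = links n A A + card (SIGMA i:{1..n}. ?out i)"
    using fin by simp
  also have "card (SIGMA i:{1..n}. ?out i) \<le> card (edge_boundary n A)"
  proof (rule card_inj_on_le[of ?f])
    show "inj_on ?f (SIGMA i:{1..n}. ?out i)"
    proof (rule inj_onI, clarsimp)
      fix i x j y
      assume *: "x \<in> A" "flip i x \<notin> A" "y \<in> A" "flip j y \<notin> A" "{x, flip i x} = {y, flip j y}"
        "Suc 0 \<le> i" "i \<le> n"
      then have "x = y" "flip i x = flip j x" by (auto simp: doubleton_eq_iff)
      moreover have "flip i x i \<noteq> x i"
        using * assms by (intro flip_same_neq) auto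
      ultimately show "i = j \<and> x = y" by (metis flip_other)
    qed
    show "?f ` (SIGMA i:{1..n}. ?out i) \<subseteq> edge_boundary n A"
    proof clarsimp
      fix i x assume *: "Suc 0 \<le> i" "i \<le> n" "x \<in> A" "flip i x \<notin> A"
      then have i: "i \<in> {1..n}" and x: "x \<in> cube n" using assms by auto
      have "x j \<noteq> flip i x j \<longleftrightarrow> j = i" for j
        using flip_same_neq[OF x i] flip_other[of j i x] by (cases "j = i") auto
      then have "{j \<in> {1..n}. x j \<noteq> flip i x j} = {i}"
        using i by auto
      then have "card {j \<in> {1..n}. x j \<noteq> flip i x j} = 1" by simp
      then show "{x, flip i x} \<in> edge_boundary n A"
        unfolding edge_boundary_def cube_edges_def using * x flip_in_cube[OF x i] by blast
    qed
    have "edge_boundary n A \<subseteq> Pow (cube n)"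
      unfolding edge_boundary_def cube_edges_def using assms by auto
    then show "finite (edge_boundary n A)"
      by (rule finite_subset) (simp add: finite_cube)
  qed
  finally have "real (n * card A) \<le> real (links n A A + card (edge_boundary n A))"
    by (simp only: of_nat_le_iff)
  then show ?thesis by (simp add: excess_def algebra_simps)
qed

lemma excess_Un:
  assumes "P \<subseteq> cube n" "Q \<subseteq> cube n" "P \<inter> Q = {}"
  shows "excess n (P \<union> Q)
    = excess n P + excess n Q + merge_gain (card P) (card Q) - 2 * real (links n P Q)"
proof -
  have "card (P \<union> Q) = card P + card Q"
    using assms finite_subset_cube[OF assms(1)] finite_subset_cube[OF assms(2)]
    by (intro card_Un_disjoint) auto
  then show ?thesis
    unfolding excess_def merge_gain_def links_Un_self[OF assms] by simp
qed

text \<open>The larger side is called \<open>P\<close>, so that later estimates need not be done twice. The induction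
  proofs use that both sides are smaller than \<open>A\<close>.\<close>
lemma unequal_halves_exist:
  assumes "A \<subseteq> cube n" "1 < card A"
  obtains i v P Q where "i \<in> {1..n}" "A = P \<union> Q" "P \<inter> Q = {}" 
    "\<forall>x\<in>P. x i = v" "\<forall>x\<in>Q. x i = 1 - v" "0 < card Q" "card Q \<le> card P"
    "card P < card A" "card Q < card A"
proof -
  have fin: "finite A" using assms finite_subset_cube[of _ n] by blast
  obtain x y where xy: "x \<in> A" "y \<in> A" "x \<noteq> y"
    using assms card_le_Suc0_iff_eq[OF fin] by (metis One_nat_def not_less)
  then obtain i where i: "i \<in> {1..n}" "x i \<noteq> y i"
    using assms unfolding cube_def by (meson PiE_ext subsetD)
  let ?side = "\<lambda>v. {z \<in> A. z i = v}"
  have val: "z i = 0 \<or> z i = 1" if "z \<in> A" for z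
    using cube_value i that assms by blast
  have A: "A = ?side 0 \<union> ?side 1" using val by auto
  have ne: "?side 0 \<noteq> {}" "?side 1 \<noteq> {}" using val[OF xy(1)] val[OF xy(2)] i xy by auto
  then have pos: "0 < card (?side 0)" "0 < card (?side 1)" using fin by (simp_all add: card_gt_0_iff)
  have "card (?side 0 \<union> ?side 1) = card (?side 0) + card (?side 1)"
    using fin by (intro card_Un_disjoint) auto
  then have sum: "card A = card (?side 0) + card (?side 1)" using A by metis
  show thesis
  proof (cases "card (?side 0) \<le> card (?side 1)")
    case True
    show thesis
    proof (rule that[of i "?side 1" "?side 0" 1])
      show "A = ?side 1 \<union> ?side 0" using A by (simp only: Un_commute)
      show "card (?side 1) < card A" "card (?side 0) < card A" using sum pos by linarith+
    qed (use True i(1) pos in \<open>simp_all add: disjoint_iff\<close>)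
  next
    case False
    show thesis
    proof (rule that[of i "?side 0" "?side 1" 0])
      show "A = ?side 0 \<union> ?side 1" by (rule A)
      show "card (?side 0) < card A" "card (?side 1) < card A" using sum pos by linarith+
      show "card (?side 1) \<le> card (?side 0)" using False by linarith
    qed (use i(1) pos in \<open>simp_all add: disjoint_iff\<close>)
  qed
qed

text \<open>
  The edge-isoperimetric inequality. In the induction, the entropy gained by merging two parts pays for
  the edges between them, because the latter form a matching.
\<close>
theorem excess_nonneg:
  assumes "A \<subseteq> cube n"
  shows "0 \<le> excess n A"
  using assms
proof (induction "card A" arbitrary: A rule: less_induct)
  case less
  show ?case
  proof (cases "1 < card A")
    case True
    then obtain i v P Q where halves: "i \<in> {1..n}" "A = P \<union> Q" "P \<inter> Q = {}"
      "\<forall>x\<in>P. x i = v" "\<forall>x\<in>Q. x i = 1 - v" "0 < card Q" "card Q \<le> card P"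
      "card P < card A" "card Q < card A"
      using unequal_halves_exist less.prems by metis
    have sub: "P \<subseteq> cube n" "Q \<subseteq> cube n" using less.prems halves by auto
    have "v \<noteq> 1 - v" by arith
    then have "\<forall>x\<in>Q. x i \<noteq> v" using halves(5) by metis
    then have "links n P Q \<le> card Q"
      by (rule links_across_coordinate_le[OF halves(1) halves(4) _ sub])
    moreover have "2 * real (card Q) \<le> merge_gain (card P) (card Q)"
      using halves by (intro merge_gain_ge_twice) auto
    moreover have "0 \<le> excess n P" "0 \<le> excess n Q"
      using less.hyps halves(8,9) sub by blast+
    ultimately show ?thesis
      using excess_Un[OF sub halves(3)] unfolding halves(2) by linarith
  next
    case False
    have fin: "finite A" using less.prems finite_subset_cube[of _ n] by blast
    have "card {x \<in> A. flip i x \<in> A} = 0" if "i \<in> {1..n}" for i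
    proof -
      have "flip i x \<noteq> x" if "x \<in> A" for x
        using flip_same_neq[of x n i] \<open>i \<in> {1..n}\<close> that less.prems by auto
      moreover have "x = y" if "x \<in> A" "y \<in> A" for x y
        using False card_le_Suc0_iff_eq[OF fin] that by auto
      ultimately have "{x \<in> A. flip i x \<in> A} = {}" by blast
      then show ?thesis by (simp only: card.empty)
    qed
    then have "links n A A = 0" by (simp add: links_def)
    moreover have "card A = 0 \<or> card A = 1" using False by linarith
    ultimately show ?thesis by (auto simp: excess_def)
  qed
qed

section \<open>Sets at small distance from a subcube\<close>

lemma subcube_subset_cube: "is_subcube n C \<Longrightarrow> C \<subseteq> cube n"
  unfolding is_subcube_def by blast

text \<open>Here \<open>t\<close> is the dimension: a subcube is \<open>t\<close>-regular.\<close>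
lemma subcube_inner_links:
  assumes "is_subcube n C"
  obtains t where "\<And>X. X \<subseteq> C \<Longrightarrow> links n X C = t * card X"
proof -
  obtain S a where S: "S \<subseteq> {1..n}" and C: "C = {x \<in> cube n. \<forall>i \<in> S. x i = a i}"
    using assms is_subcube_def by auto
  have flip_iff: "flip i x \<in> C \<longleftrightarrow> i \<notin> S" if "x \<in> C" "i \<in> {1..n}" for i x
  proof
    assume "flip i x \<in> C"
    then show "i \<notin> S"
      using flip_same_neq[of x n i] that C by auto
  next
    assume "i \<notin> S"
    then show "flip i x \<in> C"
      using that flip_in_cube[of x n i] C flip_other[of _ i x] by (auto, metis)
  qed
  show thesis
  proof (rule that[of "card ({1..n} - S)"])
    fix X assume X: "X \<subseteq> C"
    have "links n X C = (\<Sum>i\<in>{1..n}. if i \<in> {1..n} - S then card X else 0)"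
      unfolding links_def
    proof (rule sum.cong[OF refl])
      fix i assume i: "i \<in> {1..n}"
      have "{x \<in> X. flip i x \<in> C} = (if i \<in> S then {} else X)"
        using flip_iff[OF _ i] X by auto
      then show "card {x \<in> X. flip i x \<in> C} = (if i \<in> {1..n} - S then card X else 0)"
        using i by simp
    qed
    also have "\<dots> = (\<Sum>i\<in>{1..n} - S. card X)"
      by (intro sum.mono_neutral_cong_right) auto
    finally show "links n X C = card ({1..n} - S) * card X" by simp
  qed
qed

text \<open>A point outside the subcube violates one of its equations, and only reflecting that coordinate
  can lead into the subcube.\<close>
lemma outside_subcube_links:
  assumes "is_subcube n C" "X \<subseteq> cube n" "X \<inter> C = {}"
  shows "links n X C \<le> card X"
proof -
  obtain S a where S: "S \<subseteq> {1..n}" and C: "C = {x \<in> cube n. \<forall>i \<in> S. x i = a i}"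
    using assms is_subcube_def by auto
  have fin: "finite X" using assms finite_subset_cube[of _ n] by blast
  have "links n X C = card (SIGMA i:{1..n}. {x \<in> X. flip i x \<in> C})"
    using fin by (simp add: links_def)
  also have "\<dots> \<le> card X"
  proof (rule card_inj_on_le[of snd])
    show "inj_on snd (SIGMA i:{1..n}. {x \<in> X. flip i x \<in> C})"
    proof (rule inj_onI, clarsimp)
      fix i j x assume x: "x \<in> X" "flip i x \<in> C" "flip j x \<in> C"
      have "x \<in> cube n" "x \<notin> C" using x assms by auto
      then obtain k where k: "k \<in> S" "x k \<noteq> a k" unfolding C by blast
      then have "flip i x k = a k" "flip j x k = a k" using x C by auto
      then have "k = i" "k = j" using k flip_other by metis+
      then show "i = j" by simp
    qed
  qed (use fin in auto)
  finally show ?thesis .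
qed

text \<open>
  Let \<open>B\<close> be the part missing from the subcube \<open>C\<close> and \<open>E\<close> the part of \<open>A\<close> outside it, of sizes
  \<open>b\<close> and \<open>e\<close>. Regularity of \<open>C\<close> expresses the pairs inside \<open>A \<inter> C\<close> through those inside
  \<open>B\<close>. The isoperimetric inequality bounds the pairs inside \<open>B\<close> and inside \<open>E\<close> by
  \<open>b log 2 b\<close> and \<open>e log 2 e\<close>, and at most \<open>e\<close> edges join \<open>E\<close> to \<open>C\<close>. Altogether
  \<open>A\<close> spans at most \<open>(M - d) log 2 M + d log 2 d\<close> ordered pairs of neighbours, up to a term
  linear in \<open>d = b + e\<close>.
\<close>
lemma excess_near_subcube:
  assumes A: "A \<subseteq> cube n" and C: "is_subcube n C"
    and d: "d = card (sym_diff A C)" "0 < d" "d < card A"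
  shows "real d * log 2 (real (card A) / real d) - 3 * real d < excess n A"
proof -
  define K B E where "K = A \<inter> C" and "B = C - A" and "E = A - C"
  note Csub = subcube_subset_cube[OF C]
  have sub: "K \<subseteq> cube n" "B \<subseteq> cube n" "E \<subseteq> cube n"
    using A Csub by (auto simp: K_def B_def E_def)
  note fin = finite_subset_cube[OF sub(1)] finite_subset_cube[OF sub(2)] finite_subset_cube[OF sub(3)]
  have disj: "K \<inter> B = {}" "K \<inter> E = {}" "B \<inter> E = {}" "E \<inter> C = {}"
    by (auto simp: K_def B_def E_def)
  have AC: "A = K \<union> E" "C = K \<union> B" "sym_diff A C = B \<union> E"
    by (auto simp: K_def B_def E_def)
  obtain t where t: "\<And>X. X \<subseteq> C \<Longrightarrow> links n X C = t * card X"
    using subcube_inner_links[OF C] by metis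
  define M T b e where "M = real (card A)" and "T = real (card C)"
    and "b = real (card B)" and "e = real (card E)"
  have cards: "M = real (card K) + e" "T = real (card K) + b" "real d = b + e"
    unfolding M_def T_def b_def e_def d using AC fin disj by (simp_all add: card_Un_disjoint)
  have K: "0 < real (card K)" "0 \<le> b" "0 \<le> e"
    using cards d by (auto simp: b_def e_def M_def)
  have T: "0 < T" using K cards by simp
  have M: "0 < M" using K cards by simp

  \<comment> \<open>A subcube of dimension \<open>t\<close> has \<open>2 ^ t\<close> points; the inequality \<open>t \<le> log 2 T\<close> is
    enough, and it is the isoperimetric inequality for the \<open>t\<close>-regular set \<open>C\<close>.\<close>
  have "real t * T \<le> T * log 2 T"
    using excess_nonneg[OF Csub] t[of C] by (simp add: excess_def T_def)
  then have tT: "real t \<le> log 2 T"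
    using T by (simp add: mult.commute)
  have linksC: "links n C C = links n K K + links n B B + 2 * links n K B"
    using links_Un_self[OF sub(1,2) disj(1)] AC by simp
  have "links n B C = links n C B" using links_commute sub Csub by blast
  also have "\<dots> = links n K B + links n B B"
    using AC links_Un_left[OF fin(1,2) disj(1)] by simp
  finally have "links n K K + 2 * t * card B = t * card C + links n B B"
    using linksC t[of C] t[of B] AC by simp
  then have "real (links n K K + 2 * t * card B) = real (t * card C + links n B B)"
    by (simp only:)
  then have KK: "real (links n K K) = real t * (T - 2 * b) + real (links n B B)"
    by (simp add: T_def b_def algebra_simps)
  have "links n K E \<le> links n C E"
    using AC links_Un_left[OF fin(1,2) disj(1)] by simp
  also have "\<dots> \<le> card E"
    using links_commute[OF Csub sub(3)] outside_subcube_links[OF C sub(3) disj(4)] by simp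
  finally have KE: "real (links n K E) \<le> e" by (simp add: e_def)
  have "real (links n A A) = real (links n K K) + real (links n E E) + 2 * real (links n K E)"
    using links_Un_self[OF sub(1,3) disj(2)] AC by simp
  also have "\<dots> \<le> real t * (T - 2 * b) + b * log 2 b + e * log 2 e + 2 * e"
    using KK KE excess_nonneg[OF sub(2)] excess_nonneg[OF sub(3)]
    by (simp add: excess_def b_def e_def)
  also have "T - 2 * b = M - d" using cards by simp
  also have "real t * (M - d) \<le> (M - d) * log 2 T"
    using tT d by (simp add: M_def mult.commute mult_right_mono)
  finally have AA: "real (links n A A) \<le> (M - d) * log 2 T + b * log 2 b + e * log 2 e + 2 * e"
    by simp

  \<comment> \<open>Replacing \<open>log 2 T\<close> by \<open>log 2 M\<close> costs only a multiple of \<open>b\<close>, as \<open>T = M + b - e\<close>.\<close>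
  have "(M - d) * log 2 (T / M) \<le> 3 / 2 * b"
  proof (cases "e \<le> b")
    case True
    then have "log 2 (T / M) \<le> 3 / 2 * (T / M - 1)"
      using cards M by (intro log_2_le) auto
    also have "\<dots> \<le> 3 / 2 * (b / M)"
      using cards M K by (simp add: field_simps)
    finally have "(M - d) * log 2 (T / M) \<le> M * (3 / 2 * (b / M))"
      using d M K True cards by (intro mult_mono) (auto simp: M_def)
    then show ?thesis using M by simp
  next
    case False
    then have "log 2 (T / M) \<le> 0"
      using cards M T by simp
    then have "(M - d) * log 2 (T / M) \<le> 0"
      using d by (simp add: M_def mult_nonneg_nonpos)
    then show ?thesis using K by simp
  qed
  then have 1: "(M - d) * log 2 T \<le> (M - d) * log 2 M + 3 / 2 * b"
    using M T by (simp add: log_divide algebra_simps)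
  have le: "u * log 2 u \<le> u * log 2 d" if "0 \<le> u" "u \<le> d" for u :: real
    using that by (cases "u = 0") (auto intro!: mult_left_mono)
  have "b * log 2 b + e * log 2 e \<le> b * log 2 d + e * log 2 d"
    using K cards by (intro add_mono le) auto
  also have "\<dots> = d * log 2 d" using cards by (simp add: algebra_simps)
  finally have 2: "b * log 2 b + e * log 2 e \<le> d * log 2 d" .
  have "real d * log 2 (M / real d) = d * log 2 M - d * log 2 d"
    using M d by (simp add: log_divide algebra_simps)
  moreover have "(M - d) * log 2 M = M * log 2 M - d * log 2 M"
    by (simp add: algebra_simps)
  moreover have "0 < real d" using d by simp
  ultimately show ?thesis
    using AA 1 2 cards(3) K unfolding excess_def M_def[symmetric] by linarith
qed

section \<open>Sets of small excess\<close>

text \<open>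
  If \<open>P\<close> and \<open>Q\<close> lie on opposite sides of a coordinate, the reflection of \<open>Q\<close> misses
  \<open>P\<close> in only \<open>card P + card Q - 2 * links n P Q\<close> points. So freeing the coordinate \<open>i\<close> in a
  subcube near \<open>P\<close> gives a subcube near \<open>P \<union> Q\<close>.
\<close>
lemma subcube_near_double:
  assumes i: "i \<in> {1..n}" and P: "P \<subseteq> cube n" "\<forall>x\<in>P. x i = v"
    and Q: "Q \<subseteq> cube n" "\<forall>x\<in>Q. x i \<noteq> v"
    and D: "is_subcube n D" "card (sym_diff P D) < card P"
  obtains C where "is_subcube n C"
    "card (sym_diff (P \<union> Q) C) + 2 * links n P Q \<le> 2 * card (sym_diff P D) + card P + card Q"
proof -
  obtain S a where S: "S \<subseteq> {1..n}" "a \<in> S \<rightarrow> {0, 1}" and D_eq: "D = {x \<in> cube n. \<forall>i \<in> S. x i = a i}"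
    using D is_subcube_def by auto
  define C where "C = {x \<in> cube n. \<forall>i \<in> S - {i}. x i = a i}"
  have "is_subcube n C"
    unfolding is_subcube_def
  proof (intro exI conjI)
    show "S - {i} \<subseteq> {1..n}" using S by blast
    show "a \<in> S - {i} \<rightarrow> {0, 1}" using S(2) by (simp add: Pi_iff)
  qed (rule C_def)
  \<comment> \<open>If \<open>D\<close> fixed the coordinate \<open>i\<close> to the wrong value, it would be disjoint from \<open>P\<close> and
    hence too far away.\<close>
  have "P \<inter> D \<noteq> {}"
  proof
    assume "P \<inter> D = {}"
    then have "P \<subseteq> sym_diff P D" by auto
    then have "card P \<le> card (sym_diff P D)"
      using P subcube_subset_cube[OF D(1)] finite_subset_cube[of _ n] by (intro card_mono) auto
    then show False using D by simp
  qed
  then have ai: "a i = v" if "i \<in> S" using that P by (auto simp: D_eq)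
  define U W where "U = {x \<in> C. x i = v}" and "W = {x \<in> C. x i \<noteq> v}"
  have U: "U = {x \<in> D. x i = v}"
    unfolding U_def C_def D_eq using ai by auto
  have UW: "U \<subseteq> cube n" "W \<subseteq> cube n" by (auto simp: U_def W_def C_def)
  have fin: "finite P" "finite Q" "finite D" "finite U" "finite W"
    using P Q UW subcube_subset_cube[OF D(1)] finite_subset_cube[of _ n] by blast+
  have PU: "card (sym_diff P U) \<le> card (sym_diff P D)"
    using fin P by (intro card_mono) (auto simp: U)
  have flip_W: "flip i x \<in> U" if "x \<in> W" for x
  proof -
    have x: "x \<in> cube n" "x i \<noteq> v" using that by (auto simp: W_def C_def)
    have "flip i x \<in> C"
      using that flip_in_cube[OF x(1) i] flip_other[of _ i x] by (auto simp: W_def C_def)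
    obtain u where "u \<in> P" using \<open>P \<inter> D \<noteq> {}\<close> by auto
    then have "v = 0 \<or> v = 1" using cube_value[OF _ i, of u] P by auto
    then have "flip i x i = v"
      using cube_value[OF x(1) i] x(2) by (auto simp: flip_same)
    with \<open>flip i x \<in> C\<close> show ?thesis by (simp add: U_def)
  qed
  have flip_U: "flip i x \<in> W" if "x \<in> U" for x
  proof -
    have x: "x \<in> cube n" "x i = v" using that by (auto simp: U_def C_def)
    have "flip i x \<in> C"
      using that flip_in_cube[OF x(1) i] flip_other[of _ i x] by (auto simp: U_def C_def)
    then show ?thesis
      using flip_same_neq[OF x(1) i] x by (simp add: W_def)
  qed
  have ff: "flip i (flip i x) = x" if "x \<in> cube n" for x
    using flip_flip that i by blast
  have "card (sym_diff Q W) = card (flip i ` sym_diff Q W)"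
    using Q UW by (intro card_image[symmetric] inj_on_subset[OF inj_on_flip[OF i]]) auto
  also have "flip i ` sym_diff Q W \<subseteq> sym_diff P (flip i ` Q) \<union> sym_diff P U"
  proof
    fix y assume "y \<in> flip i ` sym_diff Q W"
    then obtain x where x: "y = flip i x" "x \<in> sym_diff Q W" by auto
    have xc: "x \<in> cube n" using x Q UW by auto
    have "flip i x \<in> U \<longleftrightarrow> x \<in> W" using flip_W flip_U ff[OF xc] by metis
    moreover have "flip i x \<in> flip i ` Q \<longleftrightarrow> x \<in> Q"
      using ff xc Q by (metis image_iff subsetD)
    ultimately show "y \<in> sym_diff P (flip i ` Q) \<union> sym_diff P U"
      using x by auto
  qed
  then have "card (flip i ` sym_diff Q W) \<le> card (sym_diff P (flip i ` Q) \<union> sym_diff P U)"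
    using fin by (intro card_mono) auto
  also have "\<dots> \<le> card (sym_diff P (flip i ` Q)) + card (sym_diff P U)"
    by (rule card_Un_le)
  finally have QW: "card (sym_diff Q W) \<le> card (sym_diff P (flip i ` Q)) + card (sym_diff P U)" .
  have PQ: "card (sym_diff P (flip i ` Q)) + 2 * links n P Q = card P + card Q"
  proof -
    have "P \<inter> flip i ` Q = {x \<in> P. flip i x \<in> Q}"
    proof (intro set_eqI iffI)
      fix x assume "x \<in> P \<inter> flip i ` Q"
      then show "x \<in> {x \<in> P. flip i x \<in> Q}" using ff Q by auto
    next
      fix x assume "x \<in> {x \<in> P. flip i x \<in> Q}"
      then show "x \<in> P \<inter> flip i ` Q" using ff[of x] P by force
    qed
    then have "links n P Q = card (P \<inter> flip i ` Q)"
      using links_across_coordinate[OF i P(2) Q(2)] by simp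
    moreover have "card (sym_diff P R) + 2 * card (P \<inter> R) = card P + card R" if "finite R" for R
    proof -
      have "card (sym_diff P R) = card (P - R) + card (R - P)"
        using fin that by (intro card_Un_disjoint) auto
      moreover have "card P = card (P \<inter> R) + card (P - R)" "card R = card (R \<inter> P) + card (R - P)"
        using fin that by (simp_all add: card_Int_Diff)
      ultimately show ?thesis by (simp add: Int_commute)
    qed
    moreover have "card (flip i ` Q) = card Q"
      using Q by (intro card_image inj_on_subset[OF inj_on_flip[OF i]]) auto
    ultimately show ?thesis using fin by simp
  qed
  have "sym_diff (P \<union> Q) C = sym_diff P U \<union> sym_diff Q W"
    using P Q by (auto simp: U_def W_def)
  then have "card (sym_diff (P \<union> Q) C) \<le> card (sym_diff P U) + card (sym_diff Q W)"
    by (simp add: card_Un_le)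
  then show thesis
    using that[OF \<open>is_subcube n C\<close>] QW PQ PU by linarith
qed

text \<open>
  For \<open>x \<le> 1 / 16\<close> the logarithm of \<open>1 / x\<close> is at least \<open>4\<close>, so
  \<open>x log 2 (1 / x) - 3 x \<ge> x\<close>, and \<open>x\<close> is less than the relative excess if it is not \<open>0\<close>.
\<close>
lemma near_subcube_bootstrap:
  assumes "A \<subseteq> cube n" "is_subcube n C" "excess n A \<le> card A / 128"
    and "real (card (sym_diff A C)) \<le> card A / 16"
  shows "real (card (sym_diff A C)) \<le> card A / 32"
proof (rule ccontr)
  let ?d = "real (card (sym_diff A C))"
  assume far: "\<not> ?thesis"
  then have d: "0 < ?d" by (smt (verit) of_nat_0_le_iff divide_nonneg_nonneg)
  then have M: "0 < real (card A)" using assms(4) by simp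
  have "log 2 16 \<le> log 2 (real (card A) / ?d)"
    using assms(4) d M by (subst log_le_cancel_iff) (auto simp: field_simps)
  moreover have "log 2 (16::real) = 4"
    using log_pow_cancel[of 2 4] by simp
  ultimately have "?d * 4 \<le> ?d * log 2 (real (card A) / ?d)"
    using d by (intro mult_left_mono) auto
  moreover have "?d * log 2 (real (card A) / ?d) - 3 * ?d < excess n A"
    using assms d M by (intro excess_near_subcube) auto
  ultimately show False using far assms(3) by linarith
qed

text \<open>
  Induction on the size, cutting into parts of sizes \<open>a \<ge> b\<close>. If \<open>2 b \<le> a\<close>, the entropy gain
  forces \<open>b\<close> to be tiny and leaves the larger part with no more relative excess than the whole, so its
  subcube serves for \<open>A\<close> too. Otherwise the parts are almost perfectly matched, one of them has
  relative excess at most that of the whole, and its subcube is doubled.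
\<close>
theorem near_subcube_if_small_excess:
  assumes "A \<subseteq> cube n" "A \<noteq> {}" "excess n A \<le> card A / 128"
  shows "\<exists>C. is_subcube n C \<and> real (card (sym_diff A C)) \<le> card A / 32"
  using assms
proof (induction "card A" arbitrary: A rule: less_induct)
  case less
  have fin: "finite A" using less.prems finite_subset_cube[of _ n] by blast
  show ?case
  proof (cases "1 < card A")
    case False
    then have "card A = 1" using fin less.prems by (simp add: card_gt_0_iff Suc_leI le_antisym not_less)
    then obtain x where x: "A = {x}" by (auto simp: card_1_singleton_iff)
    have "x \<in> cube n" using less.prems x by simp
    moreover have "y = x" if "y \<in> cube n" "\<forall>i\<in>{1..n}. y i = x i" for y
      using that \<open>x \<in> cube n\<close> unfolding cube_def by (meson PiE_ext)
    ultimately have "A = {y \<in> cube n. \<forall>i\<in>{1..n}. y i = x i}"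
      using x by auto
    then have "is_subcube n A"
      unfolding is_subcube_def
    proof (intro exI conjI)
      show "x \<in> {1..n} \<rightarrow> {0, 1}" using \<open>x \<in> cube n\<close> by (simp add: cube_def PiE_def)
    qed auto
    then show ?thesis by (intro exI[of _ A]) simp
  next
    case True
    then obtain i v P Q where halves: "i \<in> {1..n}" "A = P \<union> Q" "P \<inter> Q = {}"
      "\<forall>x\<in>P. x i = v" "\<forall>x\<in>Q. x i = 1 - v" "0 < card Q" "card Q \<le> card P"
      "card P < card A" "card Q < card A"
      using unequal_halves_exist less.prems by metis
    have sub: "P \<subseteq> cube n" "Q \<subseteq> cube n" using less.prems halves by auto
    have finPQ: "finite P" "finite Q" using sub finite_subset_cube[of _ n] by auto
    define a b k where "a = real (card P)" and "b = real (card Q)" and "k = real (links n P Q)"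
    have M: "real (card A) = a + b"
      using halves finPQ by (simp add: a_def b_def card_Un_disjoint)
    have ab: "0 < b" "b \<le> a" using halves by (auto simp: a_def b_def)
    have "v \<noteq> 1 - v" by arith
    then have Qv: "\<forall>x\<in>Q. x i \<noteq> v" and Pv: "\<forall>x\<in>P. x i \<noteq> 1 - v"
      using halves(4,5) by metis+
    have k: "k \<le> b"
      using links_across_coordinate_le[OF halves(1) halves(4) Qv sub] by (simp add: k_def b_def)
    have nonneg: "0 \<le> excess n P" "0 \<le> excess n Q" using excess_nonneg sub by auto
    have split: "excess n P + excess n Q + merge_gain a b - 2 * k \<le> (a + b) / 128"
      using less.prems(3) excess_Un[OF sub halves(3)] M halves(2) by (simp add: a_def b_def k_def)
    have "\<exists>C. is_subcube n C \<and> real (card (sym_diff A C)) \<le> card A / 16"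
    proof (cases "2 * b \<le> a")
      case True
      have gain: "9 / 4 * b \<le> merge_gain a b" using merge_gain_unbalanced ab True by blast
      then have "excess n P \<le> a / 128" and b: "b \<le> (a + b) / 32"
        using split nonneg k ab by (auto simp: field_simps)
      then obtain C where C: "is_subcube n C" "real (card (sym_diff P C)) \<le> a / 32"
        using less.hyps[of P] halves sub ab unfolding a_def b_def by fastforce
      have "card (sym_diff A C) \<le> card (sym_diff P C \<union> Q)"
        using halves finPQ subcube_subset_cube[OF C(1)] finite_subset_cube[of _ n] by (intro card_mono) auto
      also have "\<dots> \<le> card (sym_diff P C) + card Q" by (rule card_Un_le)
      finally have "real (card (sym_diff A C)) \<le> a / 32 + b"
        using C by (simp add: b_def)
      then have "real (card (sym_diff A C)) \<le> card A / 16"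
        using b M ab by (simp add: field_simps)
      then show ?thesis using C by blast
    next
      case False
      then have gain: "(a + 3 * b) / 2 \<le> merge_gain a b" using merge_gain_balanced ab by simp
      \<comment> \<open>The gain \<open>(a + 3 b) / 2\<close> equals both \<open>2 b + (a - b) / 2\<close> and \<open>(a + b) - (a - b) / 2\<close>:
        the first form with \<open>k \<le> b\<close> gives \<open>(a - b) / 2 \<le> (a + b) / 128\<close>, and with this
        the second bounds the number of unmatched points by twice \<open>(a + b) / 128\<close>.\<close>
      then have miss: "(a + b) - 2 * k \<le> (a + b) / 64"
        using split nonneg k by (simp add: field_simps)
      have double: "\<exists>C. is_subcube n C \<and> real (card (sym_diff A C)) \<le> card A / 16"
        if Rw: "R \<subseteq> cube n" "\<forall>x\<in>R. x i = w" and R'w: "R' \<subseteq> cube n" "\<forall>x\<in>R'. x i \<noteq> w"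
          and A: "A = R \<union> R'" and R: "0 < card R" "card R < card A"
          and cards: "real (card R) + real (card R') = a + b" "real (card R) \<le> a" "real (links n R R') = k"
          and ex: "excess n R \<le> card R / 128" for R R' w
      proof -
        obtain D where D: "is_subcube n D" "real (card (sym_diff R D)) \<le> card R / 32"
          using less.hyps[of R] R Rw(1) ex by fastforce
        then have "card (sym_diff R D) < card R" using R by linarith
        then obtain C where C: "is_subcube n C"
          "card (sym_diff A C) + 2 * links n R R' \<le> 2 * card (sym_diff R D) + card R + card R'"
          using subcube_near_double[OF halves(1) Rw R'w D(1)] A by metis
        have "real (card (sym_diff A C) + 2 * links n R R')
            \<le> real (2 * card (sym_diff R D) + card R + card R')"
          using C(2) by (simp only: of_nat_le_iff)
        then have "real (card (sym_diff A C)) + 2 * k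
            \<le> 2 * real (card (sym_diff R D)) + real (card R) + real (card R')"
          by (simp only: of_nat_add of_nat_mult of_nat_numeral cards(3))
        then have "real (card (sym_diff A C)) \<le> a / 16 + (a + b) / 64"
          using D(2) miss cards(1,2) by linarith
        \<comment> \<open>Doubling doubles the error \<open>a / 32\<close>; that is affordable as \<open>a \<le> 2 / 3 * (a + b)\<close>.\<close>
        also have "\<dots> \<le> (a + b) / 16" using False ab by (simp add: field_simps)
        finally have "real (card (sym_diff A C)) \<le> card A / 16" unfolding M .
        then show ?thesis using C(1) by (intro exI conjI)
      qed
      have "2 * k \<le> merge_gain a b" using gain k ab by simp
      then have "excess n P + excess n Q \<le> a / 128 + b / 128"
        using split by simp
      then consider "excess n P \<le> a / 128" | "excess n Q \<le> b / 128" by linarith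
      then show ?thesis
      proof cases
        case 1
        have "0 < card P" using halves(6,7) by linarith
        then show ?thesis
          using 1 ab by (intro double[OF sub(1) halves(4) sub(2) Qv halves(2) _ halves(8)])
            (simp_all only: a_def b_def k_def order_refl)
      next
        case 2
        have "A = Q \<union> P" using halves(2) by (simp only: Un_commute)
        then show ?thesis
          using 2 ab links_commute[OF sub]
          by (intro double[OF sub(2) halves(5) sub(1) Pv _ halves(6,9)])
            (simp_all only: a_def b_def k_def add.commute)
      qed
    qed
    then obtain C where "is_subcube n C" "real (card (sym_diff A C)) \<le> card A / 16"
      by (elim exE conjE)
    then show ?thesis
      using near_subcube_bootstrap[OF less.prems(1) _ less.prems(3)] by (intro exI[of _ C] conjI)
  qed
qed

section \<open>The function defining \<open>\<delta>\<^sub>0\<close>\<close>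

text \<open>The function on the left-hand side of the equation that defines \<open>\<delta>\<^sub>0\<close>.\<close>
definition stability_curve :: "real \<Rightarrow> real" where
  "stability_curve x = x * log 2 (1 / x) - 3 * x"

lemma stability_curve_strict_mono:
  assumes "0 < y" "y < x" "x \<le> 1 / 32"
  shows "stability_curve y < stability_curve x"
proof -
  have eq: "stability_curve x - stability_curve y
      = (x - y) * (log 2 (1 / x) - 3) - y * log 2 (x / y)"
    using assms by (simp add: stability_curve_def log_divide algebra_simps)
  have "y * log 2 (x / y) \<le> y * (3 / 2 * (x / y - 1))"
    using assms by (intro mult_left_mono log_2_le) auto
  also have "\<dots> = 3 / 2 * (x - y)" using assms by (simp add: field_simps)
  finally have 1: "y * log 2 (x / y) \<le> 3 / 2 * (x - y)" .
  have "log 2 32 \<le> log 2 (1 / x)"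
    using assms by (subst log_le_cancel_iff) (auto simp: field_simps)
  moreover have "log 2 (32::real) = 5" using log_pow_cancel[of 2 5] by simp
  ultimately have "(x - y) * 2 \<le> (x - y) * (log 2 (1 / x) - 3)"
    using assms by (intro mult_left_mono) auto
  then show ?thesis using 1 eq assms by simp
qed

text \<open>
  A root exists by the intermediate value theorem on an interval ending at \<open>1 / 32\<close>, where the curve has
  the value \<open>1 / 16\<close>; monotonicity up to there makes it the least one.
\<close>
lemma delta0_small:
  assumes "0 < \<epsilon>" "\<epsilon> \<le> 1 / 16"
  shows "0 < delta0 \<epsilon>" "stability_curve (delta0 \<epsilon>) = \<epsilon>"
proof -
  \<comment> \<open>Near \<open>0\<close> the curve is small: at \<open>s\<^sup>2\<close> it is at most \<open>2 s\<^sup>2 log 2 (1 / s) \<le> 3 s = \<epsilon>\<close>.\<close>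
  define s where "s = \<epsilon> / 3"
  have s: "0 < s" "s \<le> 1 / 48" using assms by (auto simp: s_def)
  have s2: "0 < s ^ 2" "s ^ 2 \<le> 1 / 32"
    using s power_mono[of s "1 / 48" 2] by (auto simp: power2_eq_square)
  have "stability_curve (s ^ 2) \<le> 2 * s ^ 2 * log 2 (1 / s)"
    using s by (simp add: stability_curve_def log_divide log_nat_power)
  also have "\<dots> \<le> 2 * s ^ 2 * (3 / 2 * (1 / s - 1))"
    using s by (intro mult_left_mono log_2_le) auto
  also have "\<dots> \<le> \<epsilon>"
    using s by (simp add: s_def field_simps power2_eq_square)
  finally have lo: "stability_curve (s ^ 2) \<le> \<epsilon>" .
  have "log 2 (32::real) = 5" using log_pow_cancel[of 2 5] by simp
  then have hi: "\<epsilon> \<le> stability_curve (1 / 32)"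
    using assms by (simp add: stability_curve_def)
  have "continuous_on {s ^ 2 .. 1 / 32} stability_curve"
    unfolding stability_curve_def log_def using s2 by (intro continuous_intros) auto
  then obtain r where r: "s ^ 2 \<le> r" "r \<le> 1 / 32" "stability_curve r = \<epsilon>"
    using IVT'[of stability_curve "s ^ 2" \<epsilon> "1 / 32"] lo hi s2 by auto
  have r_pos: "0 < r" using r(1) s2(1) by linarith
  have "delta0 \<epsilon> = r"
    unfolding delta0_def stability_curve_def[symmetric]
  proof (rule Least_equality)
    show "0 < r \<and> stability_curve r = \<epsilon>" using r r_pos by simp
    show "r \<le> y" if "0 < y \<and> stability_curve y = \<epsilon>" for y
      using stability_curve_strict_mono[of y r] that r by linarith
  qed
  then show "0 < delta0 \<epsilon>" "stability_curve (delta0 \<epsilon>) = \<epsilon>" using r r_pos by simp_all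
qed

text \<open>For \<open>\<epsilon> = 0\<close> the small root degenerates to \<open>0\<close>, which is excluded, and the least positive
  root is the other zero of the curve.\<close>
lemma delta0_zero: "delta0 0 = 1 / 8"
  unfolding delta0_def
proof (rule Least_equality)
  have "log 2 (8::real) = 3" using log_pow_cancel[of 2 3] by simp
  then show "0 < 1 / (8::real) \<and> 1 / 8 * log 2 (1 / (1 / 8)) - 3 * (1 / (8::real)) = 0" by simp
  show "1 / 8 \<le> y" if "0 < y \<and> y * log 2 (1 / y) - 3 * y = 0" for y :: real
  proof -
    have y: "0 < y" and "y * log 2 (1 / y) - 3 * y = 0"
      using that by blast+
    then have "y * (log 2 (1 / y) - 3) = 0" by (simp only: right_diff_distrib mult.commute)
    then have "log 2 (1 / y) - 3 = 0" using y by (simp only: mult_eq_0_iff) simp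
    then have "log 2 (1 / y) = 3" by simp
    then have "2 powr 3 = 1 / y" using y powr_log_cancel[of 2 "1 / y"] by simp
    then show ?thesis using y by (simp add: field_simps)
  qed
qed

text \<open>
  For negative \<open>\<epsilon>\<close> the hypothesis contradicts the isoperimetric inequality. For
  \<open>0 \<le> \<epsilon> \<le> 1 / 128\<close> there is a subcube at relative distance \<open>x \<le> 1 / 32\<close>. When
  \<open>\<epsilon>\<close> is positive and \<open>x \<ge> \<delta>\<^sub>0 \<epsilon>\<close>, monotonicity of the curve up to \<open>1 / 32\<close> would contradict the
  lower bound for the excess near a subcube.
\<close>
theorem theorem8:
  shows "\<exists>c::real. c > 0 \<and>
    (\<forall>(n::nat) (A :: (nat \<Rightarrow> nat) set) (\<epsilon>::real).
       n \<ge> 1 \<longrightarrow> A \<subseteq> cube n \<longrightarrow> A \<noteq> {} \<longrightarrow> \<epsilon> \<le> c \<longrightarrow>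
       real (card (edge_boundary n A)) \<le>
         real (card A) * log 2 (2 ^ n / real (card A)) + \<epsilon> * real (card A) \<longrightarrow>
       (\<exists>C. is_subcube n C \<and> real (card (sym_diff A C)) < delta0 \<epsilon> * real (card A)))"
proof (intro exI[of _ "1 / 128"] conjI allI impI)
  show "0 < (1 / 128 :: real)" by simp
  fix n :: nat and A :: "(nat \<Rightarrow> nat) set" and \<epsilon> :: real
  assume A: "A \<subseteq> cube n" "A \<noteq> {}" and \<epsilon>: "\<epsilon> \<le> 1 / 128"
    and bound: "real (card (edge_boundary n A)) \<le>
         real (card A) * log 2 (2 ^ n / real (card A)) + \<epsilon> * real (card A)"
  have M: "0 < real (card A)" using A finite_subset_cube[of _ n] by (auto simp: card_gt_0_iff)
  have "log 2 (2 ^ n / real (card A)) = real n - log 2 (real (card A))"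
    using M by (simp add: log_divide log_nat_power)
  then have ex: "excess n A \<le> \<epsilon> * card A"
    using excess_le_edge_boundary[OF A(1)] bound by simp
  then have "0 \<le> \<epsilon> * real (card A)" using excess_nonneg[OF A(1)] by linarith
  then have \<epsilon>0: "0 \<le> \<epsilon>" using M by (simp add: zero_le_mult_iff)
  have "excess n A \<le> card A / 128"
    using ex mult_right_mono[OF \<epsilon>, of "card A"] by simp
  then obtain C where C: "is_subcube n C" "real (card (sym_diff A C)) \<le> card A / 32"
    using near_subcube_if_small_excess A by blast
  define d where "d = real (card (sym_diff A C))"
  define x where "x = d / card A"
  have x: "0 \<le> x" "x \<le> 1 / 32" and d: "d = x * card A"
    using C M by (auto simp: x_def d_def field_simps)
  have "x < delta0 \<epsilon>"
  proof (cases "\<epsilon> = 0")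
    case True
    then show ?thesis using x delta0_zero by simp
  next
    case False
    then have \<epsilon>_pos: "0 < \<epsilon>" "\<epsilon> \<le> 1 / 16" using \<epsilon>0 \<epsilon> by auto
    note delta0 = delta0_small[OF \<epsilon>_pos]
    show ?thesis
    proof (rule ccontr)
      assume "\<not> x < delta0 \<epsilon>"
      then have le: "delta0 \<epsilon> \<le> x" by simp
      then have "0 < x" using delta0 by simp
      then have "0 < d" using M d by simp
      moreover have "d < card A" using C M by (simp add: d_def)
      ultimately have "d * log 2 (card A / d) - 3 * d < excess n A"
        using excess_near_subcube[OF A(1) C(1) refl] unfolding d_def by simp
      also have "d * log 2 (card A / d) - 3 * d = stability_curve x * card A"
        using M by (simp add: stability_curve_def x_def field_simps)
      finally have "stability_curve x * card A < \<epsilon> * card A" using ex by simp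
      then have "stability_curve x < \<epsilon>" using M by simp
      moreover have "\<epsilon> \<le> stability_curve x"
        using stability_curve_strict_mono[of "delta0 \<epsilon>" x] delta0 le x by fastforce
      ultimately show False by simp
    qed
  qed
  then have "d < delta0 \<epsilon> * card A" using d M by simp
  then show "\<exists>C. is_subcube n C \<and> real (card (sym_diff A C)) < delta0 \<epsilon> * real (card A)"
    using C d_def by blast
qed

end
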